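(* Let $\mathbf{C}$ be the natural deduction system described in the context. For any deduction in $\mathbf{C}$, there is a deduction in $\mathbf{C}$ in normal form of the same conclusion from the same undischarged assumptions.
   Context: Formulas are built from atomic formulas (formulas containing no connective) by the connectives $\neg$ (unary), $\supset$, $\land$, $\lor$. Deductions in $\mathbf{C}$ are trees of formula occurrences whose leaves are assumptions; each assumption belongs to an assumption class marked by a number, and a rule discharging class $i$ (written $[X]^i$) discharges all assumptions of that class above the indicated premise. A single assumption $A$ is a deduction of $A$ from $A$. Rules ($C$ arbitrary): $\land I$: from $A$, $B$, and a deduction of $C$ from $[A\land B]$, infer $C$. $\land E$: from $A\land B$ and a deduction of $C$ from $[A]$, $[B]$, infer $C$. $\lor I$: from $A$ (or from $B$) and a deduction of $C$ from $[A\lor B]$, infer $C$. $\lor E$: from $A\lor B$, a deduction of $C$ from $[A]$, and a deduction of $C$ from $[B]$, infer $C$. $\supset I$: from $B$ and a deduction of $C$ from $[A\supset B]$, infer $C$. $TR$ (an introduction rule for $\supset$): from a deduction of $C$ from $[A]$ and a deduction of $C$ from $[A\supset B]$, infer $C$. $\supset E$: from $A\supset B$, $A$, and a deduction of $C$ from $[B]$, infer $C$. $\neg I$: from a deduction of $C$ from $[A]$ and a deduction of $C$ from $[\neg A]$, infer $C$. $\neg E$: from $\neg A$ and $A$, infer $C$. Introduction rules: $\land I,\lor I,\supset I,TR,\neg I$; elimination rules: $\land E,\lor E,\supset E,\neg E$. In elimination rules $A\land B, A\lor B, A\supset B,\neg A$ are the major premises; premises in the place of $C$ (in any rule) are arbitrary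 premises; the discharged $A\land B$, $A\lor B$, $A\supset B$ (in $\supset I$ and $TR$), $\neg A$ (in $\neg I$) are the major assumptions discharged by the introduction rule. Convention: there is no vacuous discharge above arbitrary premises (every discharge in a rule application above an arbitrary premise discharges at least one assumption occurrence, except that $\land E$ may discharge only one of $A$, $B$). A maximal formula is an occurrence of a formula with main connective $\ast$ that is both the major premise of an application of $\ast E$ and the major assumption discharged by an application of $\ast I$ (or of $TR$ when $\ast$ is $\supset$). A segment is a sequence $C_1,\dots,C_n$ of occurrences of the same formula such that for all $i<n$, $C_i$ is an arbitrary premise of a rule application whose conclusion is $C_{i+1}$, $C_n$ is not an arbitrary premise of any rule application, and either $n>1$, or $n\ge 1$ and $C_1$ is the conclusion of an application of $\neg E$. A maximal segment is a segment whose last formula is the major premise of an elimination rule. A deduction is in normal form if it contains neither maximal formulas nor maximal segments.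
   Formalization: "From the same undischarged assumptions" is proved as: the undischarged assumptions of the normal deduction are among those of the given one; equality fails, e.g. for p deduced from p, q by ∧I and then ∧E discharging only p. *)

theory Defs
  imports Main
begin

datatype 'a form =
    Atom 'a
  | Neg "'a form"
  | Imp "'a form" "'a form"
  | And "'a form" "'a form"
  | Or "'a form" "'a form"

text \<open>An assumption class is identified by its number together with the formula assumed.\<close>

type_synonym 'a assm_class = "nat \<times> 'a form"

text \<open>Rule instances.  The formula arguments are the schematic \<open>A\<close> and \<open>B\<close>; the numbers are
  those of the discharged classes, in the order in which \<open>rule_premises\<close> below uses them.\<close>

datatype 'a rule =
    AndI "'a form" "'a form" nat
  | AndE "'a form" "'a form" nat nat
  | OrI1 "'a form" "'a form" nat
  | OrI2 "'a form" "'a form" nat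
  | OrE "'a form" "'a form" nat nat
  | ImpI "'a form" "'a form" nat
  | TR "'a form" "'a form" nat nat
  | ImpE "'a form" "'a form" nat
  | NegI "'a form" nat nat
  | NegE "'a form"

text \<open>\<open>Major\<close> is used for elimination rules only; \<open>Arbitrary\<close> carries the classes discharged above
  the premise.\<close>

datatype 'a premise =
    Major "'a form"
  | Minor "'a form"
  | Arbitrary "'a assm_class set"

fun rule_premises :: "'a rule \<Rightarrow> 'a premise list" where
  "rule_premises (AndI A B i) = [Minor A, Minor B, Arbitrary {(i, And A B)}]"
| "rule_premises (AndE A B i j) = [Major (And A B), Arbitrary {(i, A), (j, B)}]"
| "rule_premises (OrI1 A B i) = [Minor A, Arbitrary {(i, Or A B)}]"
| "rule_premises (OrI2 A B i) = [Minor B, Arbitrary {(i, Or A B)}]"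
| "rule_premises (OrE A B i j) = [Major (Or A B), Arbitrary {(i, A)}, Arbitrary {(j, B)}]"
| "rule_premises (ImpI A B i) = [Minor B, Arbitrary {(i, Imp A B)}]"
| "rule_premises (TR A B i j) = [Arbitrary {(i, A)}, Arbitrary {(j, Imp A B)}]"
| "rule_premises (ImpE A B i) = [Major (Imp A B), Minor A, Arbitrary {(i, B)}]"
| "rule_premises (NegI A i j) = [Arbitrary {(i, A)}, Arbitrary {(j, Neg A)}]"
| "rule_premises (NegE A) = [Major (Neg A), Minor A]"

fun discharged :: "'a premise \<Rightarrow> 'a assm_class set" where
  "discharged (Arbitrary D) = D"
| "discharged _ = {}"

text \<open>\<open>None\<close> exactly for the elimination rules.\<close>

fun major_assumption :: "'a rule \<Rightarrow> 'a form option" where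
  "major_assumption (AndI A B i) = Some (And A B)"
| "major_assumption (OrI1 A B i) = Some (Or A B)"
| "major_assumption (OrI2 A B i) = Some (Or A B)"
| "major_assumption (ImpI A B i) = Some (Imp A B)"
| "major_assumption (TR A B i j) = Some (Imp A B)"
| "major_assumption (NegI A i j) = Some (Neg A)"
| "major_assumption _ = None"

text \<open>\<open>Infer r C ds\<close> concludes \<open>C\<close> by \<open>r\<close> from the conclusions of \<open>ds\<close>, listed in the order of
  \<open>rule_premises r\<close>.\<close>

datatype 'a tree =
    Assm nat "'a form"
  | Infer "'a rule" "'a form" "'a tree list"

fun concl :: "'a tree \<Rightarrow> 'a form" where
  "concl (Assm i A) = A"
| "concl (Infer r C ds) = C"

text \<open>Normalisation can erase assumptions, even though vacuous discharge is banned: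
  for distinct atoms \<open>p\<close>, \<open>q\<close> there is a deduction of \<open>p\<close> using exactly the assumptions \<open>p\<close>, \<open>q\<close>
  (\<open>\<and>I\<close> followed by \<open>\<and>E\<close>), but by the subformula property the only normal deduction of \<open>p\<close> from
  them is the single assumption \<open>p\<close>.  Hence, as is usual, a deduction from a collection of
  assumptions is one whose undischarged assumptions are all among them.\<close>

primrec undischarged :: "'a tree \<Rightarrow> 'a assm_class set" where
  "undischarged (Assm i A) = {(i, A)}"
| "undischarged (Infer r C ds) =
     \<Union> (set (map2 (\<lambda>P U. U - discharged P) (rule_premises r) (map undischarged ds)))"

text \<open>Vacuous discharge is excluded by the last equation: only \<open>\<and>E\<close> has more than one class to
  discharge above the same premise, and there one of the two suffices.\<close>

fun fits :: "'a form \<Rightarrow> 'a premise \<Rightarrow> 'a tree \<Rightarrow> bool" where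
  "fits C (Major A) d \<longleftrightarrow> concl d = A"
| "fits C (Minor A) d \<longleftrightarrow> concl d = A"
| "fits C (Arbitrary D) d \<longleftrightarrow> concl d = C \<and> D \<inter> undischarged d \<noteq> {}"

inductive deduction :: "'a tree \<Rightarrow> bool" where
  "deduction (Assm i A)"
| "(\<And>d. d \<in> set ds \<Longrightarrow> deduction d) \<Longrightarrow> list_all2 (fits C) (rule_premises r) ds
     \<Longrightarrow> deduction (Infer r C ds)"

text \<open>An occurrence in a tree is the path leading to it from the root; the formula occurring there
  is the conclusion of the subtree.\<close>

fun subtree :: "'a tree \<Rightarrow> nat list \<Rightarrow> 'a tree option" where
  "subtree d [] = Some d"
| "subtree (Assm i A) (k # p) = None"
| "subtree (Infer r C ds) (k # p) = (if k < length ds then subtree (ds ! k) p else None)"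

text \<open>The occurrence \<open>q\<close> is a premise, of the kind \<open>P\<close>, of the application with conclusion \<open>p\<close>.\<close>

definition premise_of :: "'a tree \<Rightarrow> nat list \<Rightarrow> 'a premise \<Rightarrow> nat list \<Rightarrow> bool" where
  "premise_of d q P p \<longleftrightarrow>
     (\<exists>r C ds k. subtree d p = Some (Infer r C ds) \<and> k < length ds \<and>
        q = p @ [k] \<and> P = rule_premises r ! k)"

definition major_premise :: "'a tree \<Rightarrow> nat list \<Rightarrow> bool" where
  "major_premise d q \<longleftrightarrow> (\<exists>A p. premise_of d q (Major A) p)"

definition arbitrary_premise_of :: "'a tree \<Rightarrow> nat list \<Rightarrow> nat list \<Rightarrow> bool" where
  "arbitrary_premise_of d q p \<longleftrightarrow> (\<exists>D. premise_of d q (Arbitrary D) p)"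

text \<open>The application at \<open>p\<close> has a premise above which it discharges the class of the assumption
  at \<open>q\<close>; of several such applications the uppermost one discharges it.\<close>

definition may_discharge :: "'a tree \<Rightarrow> nat list \<Rightarrow> nat list \<Rightarrow> bool" where
  "may_discharge d p q \<longleftrightarrow>
     (\<exists>i A P p' s. subtree d q = Some (Assm i A) \<and> premise_of d p' P p \<and>
        q = p' @ s \<and> (i, A) \<in> discharged P)"

definition discharges :: "'a tree \<Rightarrow> nat list \<Rightarrow> nat list \<Rightarrow> bool" where
  "discharges d p q \<longleftrightarrow>
     may_discharge d p q \<and> (\<forall>p'. may_discharge d p' q \<longrightarrow> length p' \<le> length p)"

text \<open>Comparing formulas suffices in the next definition, since in \<open>TR\<close> and \<open>\<not>I\<close> the other
  discharged formula differs from the major assumption.  The elimination and the introduction rule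
  belong to the same connective because they share the formula.\<close>

definition major_assumption_occ :: "'a tree \<Rightarrow> nat list \<Rightarrow> bool" where
  "major_assumption_occ d q \<longleftrightarrow>
     (\<exists>p r C ds i A. subtree d p = Some (Infer r C ds) \<and> subtree d q = Some (Assm i A) \<and>
        discharges d p q \<and> major_assumption r = Some A)"

definition maximal_formula :: "'a tree \<Rightarrow> nat list \<Rightarrow> bool" where
  "maximal_formula d q \<longleftrightarrow> major_premise d q \<and> major_assumption_occ d q"

definition segment :: "'a tree \<Rightarrow> nat list list \<Rightarrow> bool" where
  "segment d qs \<longleftrightarrow>
     qs \<noteq> [] \<and>
     (\<exists>C. \<forall>q \<in> set qs. map_option concl (subtree d q) = Some C) \<and>
     (\<forall>i. Suc i < length qs \<longrightarrow> arbitrary_premise_of d (qs ! i) (qs ! Suc i)) \<and>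
     (\<nexists>p. arbitrary_premise_of d (last qs) p) \<and>
     (length qs > 1 \<or> (\<exists>A C ds. subtree d (hd qs) = Some (Infer (NegE A) C ds)))"

definition maximal_segment :: "'a tree \<Rightarrow> nat list list \<Rightarrow> bool" where
  "maximal_segment d qs \<longleftrightarrow> segment d qs \<and> major_premise d (last qs)"

definition normal :: "'a tree \<Rightarrow> bool" where
  "normal d \<longleftrightarrow> (\<nexists>q. maximal_formula d q) \<and> (\<nexists>qs. maximal_segment d qs)"

end

theory Submission
  imports Defs
begin

text \<open>The system is sound for classical two-valued semantics, so it suffices that normal deductions
  are complete.  Assumptions are split into those that may be major premises (\<open>E\<close>) and passive ones
  (\<open>P\<close>); a deduction whose major premises are all assumptions of the first kind is normal if
  introduction rules discharge major assumptions only as passive ones.  A classical sequent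
  \<open>\<Gamma> \<Rightarrow> \<Delta>\<close> is then read as follows: if \<open>C\<close> follows normally from \<open>\<Gamma>\<close> together with any single member
  of \<open>\<Delta>\<close> as a further passive assumption, then \<open>C\<close> follows normally from \<open>\<Gamma>\<close>.  Under this reading the
  left and right rules of the cut-free sequent calculus are the elimination and introduction rules,
  and every valid sequent is obtained by decomposing its formulas.\<close>

section \<open>Soundness\<close>

primrec holds :: "('a \<Rightarrow> bool) \<Rightarrow> 'a form \<Rightarrow> bool" where
  "holds v (Atom a) \<longleftrightarrow> v a"
| "holds v (Neg A) \<longleftrightarrow> \<not> holds v A"
| "holds v (Imp A B) \<longleftrightarrow> (holds v A \<longrightarrow> holds v B)"
| "holds v (And A B) \<longleftrightarrow> holds v A \<and> holds v B"
| "holds v (Or A B) \<longleftrightarrow> holds v A \<or> holds v B"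

text \<open>Two-valuedness enters only through \<open>TR\<close> and \<open>NegI\<close>: every
  valuation makes \<open>A\<close> or \<open>Imp A B\<close> true, and \<open>A\<close> or
  \<open>Neg A\<close>.\<close>

lemma deduction_sound:
  assumes "deduction d" and "\<forall>x \<in> undischarged d. holds v (snd x)"
  shows "holds v (concl d)"
  using assms
proof (induction rule: deduction.induct)
  case (1 i A)
  then show ?case by simp
next
  case (2 ds C r)
  \<comment> \<open>The semantic content of each premise; an arbitrary one yields \<open>C\<close>
    once the classes it discharges are true. What remains for each rule is a truth-table
    check.\<close>
  have "case Q of Major A \<Rightarrow> holds v A | Minor A \<Rightarrow> holds v A
      | Arbitrary D \<Rightarrow> (\<forall>x \<in> D. holds v (snd x)) \<longrightarrow> holds v C"
    if Q: "Q \<in> set (rule_premises r)" for Q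
  proof -
    note all2 = \<open>list_all2 (fits C) (rule_premises r) ds\<close>
    then have len: "length (rule_premises r) = length ds" by (rule list_all2_lengthD)
    obtain k where k: "k < length ds" "Q = rule_premises r ! k"
      using Q len by (metis in_set_conv_nth)
    have fit: "fits C Q (ds ! k)"
      using list_all2_nthD2[OF all2 k(1)] k(2) by simp
    have "undischarged (ds ! k) - discharged Q \<subseteq> undischarged (Infer r C ds)"
      using k len by (force simp: set_zip)
    with "2.prems" have "\<forall>x \<in> undischarged (ds ! k) - discharged Q. holds v (snd x)"
      by blast
    moreover have "(\<forall>x \<in> undischarged (ds ! k). holds v (snd x)) \<longrightarrow> holds v (concl (ds ! k))"
      using "2.IH" k(1) nth_mem by blast
    ultimately show ?thesis
      using fit by (cases Q) auto
  qed
  then have "\<forall>Q \<in> set (rule_premises r). case Q of Major A \<Rightarrow> holds v A | Minor A \<Rightarrow> holds v A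
      | Arbitrary D \<Rightarrow> (\<forall>x \<in> D. holds v (snd x)) \<longrightarrow> holds v C"
    by blast
  then show ?case by (cases r) auto
qed

lemma finite_undischarged: "finite (undischarged d)"
proof (induction d)
  case (Infer r C ds)
  then show ?case by (auto dest!: set_zip_rightD)
qed simp

section \<open>A compositional criterion for normality\<close>

text \<open>The innermost discharge decides the status of a class: discharged as a major assumption
  it becomes passive, even if \<open>E\<close> contains it, and otherwise it becomes
  eliminable.\<close>

definition eliminable_above :: "'a rule \<Rightarrow> nat \<Rightarrow> 'a assm_class set \<Rightarrow> 'a assm_class set" where
  "eliminable_above r k E =
     (let D = discharged (rule_premises r ! k)
      in (E - D) \<union> {x \<in> D. major_assumption r \<noteq> Some (snd x)})"

text \<open>Unlike \<open>normal\<close>, which speaks of paths from the root, this condition can be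
  checked while a tree is being assembled from its subtrees.\<close>

inductive separated :: "'a assm_class set \<Rightarrow> 'a tree \<Rightarrow> bool" where
  Assm: "separated E (Assm i A)"
| Infer: "(\<And>k A. k < length ds \<Longrightarrow> rule_premises r ! k = Major A \<Longrightarrow>
              \<exists>i B. ds ! k = Assm i B \<and> (i, B) \<in> E) \<Longrightarrow>
          (\<And>k. k < length ds \<Longrightarrow> separated (eliminable_above r k E) (ds ! k)) \<Longrightarrow>
          separated E (Infer r C ds)"

inductive_cases separated_InferE: "separated E (Infer r C ds)"

lemma eliminable_above_mono: "E \<subseteq> F \<Longrightarrow> eliminable_above r k E \<subseteq> eliminable_above r k F"
  by (auto simp: eliminable_above_def Let_def)

lemma separated_mono: "separated E d \<Longrightarrow> E \<subseteq> F \<Longrightarrow> separated F d"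
proof (induction arbitrary: F rule: separated.induct)
  case (Infer ds r E C)
  show ?case
  proof (rule separated.Infer)
    show "\<exists>i B. ds ! k = Assm i B \<and> (i, B) \<in> F"
      if "k < length ds" "rule_premises r ! k = Major A" for k A
      using Infer.hyps(1)[OF that] Infer.prems by blast
    show "separated (eliminable_above r k F) (ds ! k)" if "k < length ds" for k
      using Infer.IH[OF that] Infer.prems by (simp add: eliminable_above_mono)
  qed
qed (rule separated.Assm)

text \<open>A major premise is a leaf above which its own rule discharges nothing, so an eliminable
  class that is really used is either undischarged at the root or discharged, and thereby
  classified, on the way down.\<close>

lemma separated_relevant:
  assumes "deduction d" and "separated F d" and "F \<inter> undischarged d \<subseteq> E"
  shows "separated E d"
  using assms
proof (induction d arbitrary: E F rule: deduction.induct)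
  case (2 ds C r)
  have len: "length (rule_premises r) = length ds"
    using "2.hyps" list_all2_lengthD by blast
  have und: "undischarged (ds ! k) - discharged (rule_premises r ! k) \<subseteq> undischarged (Infer r C ds)"
    if "k < length ds" for k
    using that len by (force simp: set_zip)
  show ?case
  proof (rule separated.Infer)
    fix k A
    assume k: "k < length ds" "rule_premises r ! k = Major A"
    then obtain i B where "ds ! k = Assm i B" "(i, B) \<in> F"
      using "2.prems"(1) by (meson separated_InferE)
    then show "\<exists>i B. ds ! k = Assm i B \<and> (i, B) \<in> E"
      using und[OF k(1)] k(2) "2.prems"(2) by auto
  next
    fix k
    assume k: "k < length ds"
    then have "separated (eliminable_above r k F) (ds ! k)"
      using "2.prems"(1) by (meson separated_InferE)
    moreover have "eliminable_above r k F \<inter> undischarged (ds ! k) \<subseteq> eliminable_above r k E"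
      using und[OF k] "2.prems"(2) by (auto simp: eliminable_above_def Let_def)
    ultimately show "separated (eliminable_above r k E) (ds ! k)"
      using "2.IH" k by simp
  qed
qed (rule separated.Assm)

section \<open>Eliminable classes along a path\<close>

fun eliminable_at :: "'a assm_class set \<Rightarrow> 'a tree \<Rightarrow> nat list \<Rightarrow> 'a assm_class set" where
  "eliminable_at E (Infer r C ds) (k # q) = eliminable_at (eliminable_above r k E) (ds ! k) q"
| "eliminable_at E d q = E"

lemma subtree_ConsE:
  assumes "subtree d (k # q) = Some t"
  obtains r C ds where "d = Infer r C ds" "k < length ds" "subtree (ds ! k) q = Some t"
  using assms by (cases d) (auto split: if_splits)

lemma separated_major_premise:
  assumes "separated E d" and "subtree d p = Some (Infer r C ds)"
    and "k < length ds" and "rule_premises r ! k = Major A"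
  shows "\<exists>i B. subtree d (p @ [k]) = Some (Assm i B) \<and> (i, B) \<in> eliminable_at E d (p @ [k])"
  using assms
proof (induction p arbitrary: E d)
  case Nil
  then have d: "d = Infer r C ds" and sep: "separated E (Infer r C ds)" by simp_all
  obtain i B where "ds ! k = Assm i B" "(i, B) \<in> E"
    using sep Nil.prems(3,4) by (meson separated_InferE)
  \<comment> \<open>No rule discharges anything above a major premise.\<close>
  moreover have "E = eliminable_above r k E"
    using Nil.prems(4) by (simp add: eliminable_above_def)
  ultimately show ?case using d Nil.prems(3) by simp
next
  case (Cons l p)
  obtain r' C' ds' where d: "d = Infer r' C' ds'" "l < length ds'"
    and sub: "subtree (ds' ! l) p = Some (Infer r C ds)"
    using Cons.prems(2) by (rule subtree_ConsE)
  have "separated (eliminable_above r' l E) (ds' ! l)"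
    using Cons.prems(1) d by (meson separated_InferE)
  from Cons.IH[OF this sub Cons.prems(3,4)] d show ?case by simp
qed

section \<open>The application discharging an assumption\<close>

lemma may_discharge_iff:
  "may_discharge d p q \<longleftrightarrow>
     (\<exists>i A r C ds k s. subtree d q = Some (Assm i A) \<and> subtree d p = Some (Infer r C ds) \<and>
        k < length ds \<and> q = p @ k # s \<and> (i, A) \<in> discharged (rule_premises r ! k))"
  (is "?L \<longleftrightarrow> ?R")
proof
  assume ?L
  then show ?R unfolding may_discharge_def premise_of_def by fastforce
next
  assume ?R
  then obtain i A r C ds k s where *: "subtree d q = Some (Assm i A)"
    "subtree d p = Some (Infer r C ds)" "k < length ds" "q = p @ k # s"
    "(i, A) \<in> discharged (rule_premises r ! k)"
    by blast
  then have "premise_of d (p @ [k]) (rule_premises r ! k) p" by (simp add: premise_of_def)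
  moreover have "q = (p @ [k]) @ s" using * by simp
  ultimately show ?L unfolding may_discharge_def using * by blast
qed

lemma may_discharge_Nil: "\<not> may_discharge d p []"
  by (simp add: may_discharge_iff)

lemma may_discharge_ConsD:
  assumes "may_discharge (Infer r C ds) (l # p) (k # q)"
  shows "l = k \<and> may_discharge (ds ! k) p q"
proof -
  obtain i A r' C' ds' k' s where "subtree (Infer r C ds) (k # q) = Some (Assm i A)"
    "subtree (Infer r C ds) (l # p) = Some (Infer r' C' ds')" "k' < length ds'"
    "k # q = (l # p) @ k' # s" "(i, A) \<in> discharged (rule_premises r' ! k')"
    using assms unfolding may_discharge_iff by blast
  then show ?thesis
    unfolding may_discharge_iff by (simp split: if_splits)
qed

lemma may_discharge_ConsI:
  assumes "may_discharge (ds ! k) p q" and "k < length ds"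
  shows "may_discharge (Infer r C ds) (k # p) (k # q)"
  using assms by (simp add: may_discharge_iff)

lemma may_discharge_root:
  assumes "subtree (ds ! k) q = Some (Assm i A)" and "k < length ds"
  shows "may_discharge (Infer r C ds) [] (k # q) \<longleftrightarrow> (i, A) \<in> discharged (rule_premises r ! k)"
  using assms by (simp add: may_discharge_iff)

lemma eliminable_at_undischarged:
  assumes "subtree d q = Some (Assm i A)" and "(i, A) \<in> eliminable_at E d q"
    and "\<forall>p. \<not> may_discharge d p q"
  shows "(i, A) \<in> E"
  using assms
proof (induction q arbitrary: E d)
  case (Cons k q)
  obtain r C ds where d: "d = Infer r C ds" "k < length ds"
    and sub: "subtree (ds ! k) q = Some (Assm i A)"
    using Cons.prems(1) by (rule subtree_ConsE)
  have "\<forall>p. \<not> may_discharge (ds ! k) p q"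
    using Cons.prems(3) d by (meson may_discharge_ConsI)
  with Cons.IH[OF sub] Cons.prems(2) d have E: "(i, A) \<in> eliminable_above r k E" by simp
  have "(i, A) \<notin> discharged (rule_premises r ! k)"
  proof
    assume "(i, A) \<in> discharged (rule_premises r ! k)"
    then have "may_discharge d [] (k # q)"
      using d sub by (simp add: may_discharge_root)
    then show False using Cons.prems(3) by blast
  qed
  then show ?case using E by (simp add: eliminable_above_def Let_def)
qed simp

text \<open>Below the discharging application the status of the class is irrelevant, and above it
  nothing changes that status. Hence a class eliminable at the leaf was made so by that very
  application.\<close>

lemma eliminable_at_discharged:
  assumes "subtree d q = Some (Assm i A)" and "(i, A) \<in> eliminable_at E d q"
    and "discharges d p q" and "subtree d p = Some (Infer r C ds)"
  shows "major_assumption r \<noteq> Some A"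
  using assms
proof (induction q arbitrary: E d p)
  case Nil
  then show ?case by (simp add: discharges_def may_discharge_Nil)
next
  case (Cons k q)
  obtain r' C' ds' where d: "d = Infer r' C' ds'" "k < length ds'"
    and sub: "subtree (ds' ! k) q = Some (Assm i A)"
    using Cons.prems(1) by (rule subtree_ConsE)
  have el: "(i, A) \<in> eliminable_at (eliminable_above r' k E) (ds' ! k) q"
    using Cons.prems(2) d by simp
  have may: "may_discharge d p (k # q)"
    and top: "\<And>p'. may_discharge d p' (k # q) \<Longrightarrow> length p' \<le> length p"
    using Cons.prems(3) by (auto simp: discharges_def)
  show ?case
  proof (cases p)
    case Nil
    \<comment> \<open>The discharging application is the uppermost candidate and here it is the
      root, so no candidate lies inside the subtree.\<close>
    have "\<forall>p'. \<not> may_discharge (ds' ! k) p' q"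
      using top may_discharge_ConsI d Nil by fastforce
    with eliminable_at_undischarged[OF sub el] have "(i, A) \<in> eliminable_above r' k E" by simp
    moreover have "(i, A) \<in> discharged (rule_premises r' ! k)"
      using may Nil d sub by (simp add: may_discharge_root)
    ultimately show ?thesis
      using Cons.prems(4) Nil d by (simp add: eliminable_above_def Let_def)
  next
    case (Cons l p')
    with may d have l: "l = k" and may': "may_discharge (ds' ! k) p' q"
      using may_discharge_ConsD by blast+
    have "discharges (ds' ! k) p' q"
      unfolding discharges_def
      using may' top may_discharge_ConsI d Cons by fastforce
    moreover have "subtree (ds' ! k) p' = Some (Infer r C ds)"
      using Cons.prems(4) Cons d l by simp
    ultimately show ?thesis using Cons.IH[OF sub el] by blast
  qed
qed

text \<open>Major premises are leaves, so they conclude no application and cannot end a segment;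
  being eliminable, they are not discharged as major assumptions.\<close>

lemma separated_normal:
  assumes "separated E d"
  shows "normal d"
proof -
  have leaf: "\<exists>i B. subtree d q = Some (Assm i B) \<and> (i, B) \<in> eliminable_at E d q"
    if "major_premise d q" for q
    using that separated_major_premise[OF assms]
    unfolding major_premise_def premise_of_def by metis
  have "\<not> maximal_formula d q" for q
  proof
    assume "maximal_formula d q"
    then have maj: "major_premise d q" and occ: "major_assumption_occ d q"
      by (auto simp: maximal_formula_def)
    from leaf[OF maj] obtain i B
      where q: "subtree d q = Some (Assm i B)" "(i, B) \<in> eliminable_at E d q" by blast
    from occ q(1) show False
      unfolding major_assumption_occ_def using eliminable_at_discharged[OF q] by auto
  qed
  moreover have "\<not> maximal_segment d qs" for qs
  proof
    assume "maximal_segment d qs"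
    then have seg: "segment d qs" and maj: "major_premise d (last qs)"
      by (auto simp: maximal_segment_def)
    obtain i B where last: "subtree d (last qs) = Some (Assm i B)" using leaf[OF maj] by blast
    show False
    proof (cases "length qs > 1")
      case True
      \<comment> \<open>The index \<open>length qs - 2\<close> is that of the penultimate
        occurrence.\<close>
      then have "Suc (length qs - 2) < length qs" "qs ! Suc (length qs - 2) = last qs"
        by (cases qs; simp add: last_conv_nth; simp add: Suc_diff_Suc numeral_2_eq_2)+
      then have "arbitrary_premise_of d (qs ! (length qs - 2)) (last qs)"
        using seg unfolding segment_def by metis
      then show False using last by (auto simp: arbitrary_premise_of_def premise_of_def)
    next
      case False
      moreover from seg have "qs \<noteq> []" by (simp add: segment_def)
      ultimately obtain q where "qs = [q]" by (cases qs) auto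
      then show False using seg last by (auto simp: segment_def)
    qed
  qed
  ultimately show ?thesis by (simp add: normal_def)
qed

section \<open>Sequent rules for normal deductions\<close>

definition derivable :: "'a assm_class set \<Rightarrow> 'a assm_class set \<Rightarrow> 'a form \<Rightarrow> bool" where
  "derivable E P C \<longleftrightarrow>
     (\<exists>d. deduction d \<and> separated E d \<and> concl d = C \<and> undischarged d \<subseteq> E \<union> P)"

lemma derivable_Assm: "(i, C) \<in> E \<union> P \<Longrightarrow> derivable E P C"
  unfolding derivable_def
  by (intro exI[of _ "Assm i C"]) (auto intro: deduction.intros separated.intros)

lemma derivable_mono:
  "derivable E P C \<Longrightarrow> E \<subseteq> F \<Longrightarrow> P \<subseteq> Q \<Longrightarrow> derivable F Q C"
  unfolding derivable_def by (blast intro: separated_mono)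

text \<open>If \<open>C\<close> does not follow without \<open>x\<close>, then \<open>x\<close>
  occurs and its discharge is not vacuous. The set \<open>E - {x}\<close> is the one that
  \<open>eliminable_above\<close> leaves when \<open>x\<close> is discharged as a major
  assumption.\<close>

lemma derivable_discharge_passive:
  assumes "derivable E (insert x P) C" and "x \<notin> E" and "\<not> derivable E P C"
  obtains d where "deduction d" "separated (E - {x}) d" "concl d = C" "x \<in> undischarged d"
    "undischarged d - {x} \<subseteq> E \<union> P"
  using assms unfolding derivable_def
  by (metis Diff_empty Diff_insert0 Un_insert_right subset_insert_iff)

text \<open>If no class of \<open>D\<close> occurred, \<open>separated_relevant\<close> would make
  \<open>E\<close> suffice; so the discharge of \<open>D\<close> is not vacuous.\<close>

lemma derivable_discharge_eliminable:
  assumes "derivable (E \<union> D) P C" and "\<not> derivable E P C"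
  obtains d where "deduction d" "separated (E \<union> D) d" "concl d = C" "D \<inter> undischarged d \<noteq> {}"
    "undischarged d - D \<subseteq> E \<union> P"
proof -
  obtain d where d: "deduction d" "separated (E \<union> D) d" "concl d = C"
    "undischarged d \<subseteq> E \<union> D \<union> P"
    using assms(1) unfolding derivable_def by blast
  have "D \<inter> undischarged d \<noteq> {}"
  proof
    assume "D \<inter> undischarged d = {}"
    then have "separated E d" "undischarged d \<subseteq> E \<union> P"
      using d separated_relevant[of d "E \<union> D" E] by blast+
    then show False using assms(2) d unfolding derivable_def by blast
  qed
  with d show thesis by (intro that) auto
qed

lemma fresh_class: "finite (E :: (nat \<times> 'b) set) \<Longrightarrow> \<exists>k. (k, A) \<notin> E"
  by (metis finite_imageI fst_conv image_eqI ex_new_if_finite infinite_UNIV_nat)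

text \<open>Ensures that \<open>TR\<close> makes the class of \<open>A\<close> eliminable;
  \<open>Neg_neq\<close> does the same for \<open>NegI\<close>.\<close>

lemma Imp_neq_antecedent: "Imp A B \<noteq> A"
  by (induction A arbitrary: B) auto

lemma Neg_neq: "Neg A \<noteq> A"
  by (induction A) auto

lemmas tree_simps = eliminable_above_def Let_def less_Suc_eq Imp_neq_antecedent Neg_neq

section \<open>Introduction rules as right rules\<close>

lemma derivable_AndI:
  assumes "finite E" and "\<And>k. derivable E (insert (k, And A B) P) C"
  shows "derivable E (insert (n, A) (insert (m, B) P)) C"
\<comment> \<open>If \<open>C\<close> follows already, weakening suffices and the rule, whose
  discharge might be vacuous, is avoided.\<close>
proof (cases "derivable E P C")
  case False
  \<comment> \<open>A number fresh for \<open>E\<close> keeps the passive class apart from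
    eliminable ones; the hypothesis ranges over all \<open>k\<close> to allow this choice.\<close>
  obtain k where k: "(k, And A B) \<notin> E" using fresh_class[OF assms(1)] by blast
  obtain d where "deduction d" "separated (E - {(k, And A B)}) d" "concl d = C"
    "(k, And A B) \<in> undischarged d" "undischarged d - {(k, And A B)} \<subseteq> E \<union> P"
    using derivable_discharge_passive[OF assms(2) k False] .
  then show ?thesis
    unfolding derivable_def
    by (intro exI[of _ "Infer (AndI A B k) C [Assm n A, Assm m B, d]"])
       (auto simp: tree_simps intro!: deduction.intros separated.intros elim!: separated_mono)
qed (blast intro: derivable_mono)

lemma derivable_OrI1:
  assumes "finite E" and "\<And>k. derivable E (insert (k, Or A B) P) C"
  shows "derivable E (insert (n, A) P) C"
proof (cases "derivable E P C")
  case False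
  obtain k where k: "(k, Or A B) \<notin> E" using fresh_class[OF assms(1)] by blast
  obtain d where "deduction d" "separated (E - {(k, Or A B)}) d" "concl d = C"
    "(k, Or A B) \<in> undischarged d" "undischarged d - {(k, Or A B)} \<subseteq> E \<union> P"
    using derivable_discharge_passive[OF assms(2) k False] .
  then show ?thesis
    unfolding derivable_def
    by (intro exI[of _ "Infer (OrI1 A B k) C [Assm n A, d]"])
       (auto simp: tree_simps intro!: deduction.intros separated.intros elim!: separated_mono)
qed (blast intro: derivable_mono)

lemma derivable_OrI2:
  assumes "finite E" and "\<And>k. derivable E (insert (k, Or A B) P) C"
  shows "derivable E (insert (n, B) P) C"
proof (cases "derivable E P C")
  case False
  obtain k where k: "(k, Or A B) \<notin> E" using fresh_class[OF assms(1)] by blast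
  obtain d where "deduction d" "separated (E - {(k, Or A B)}) d" "concl d = C"
    "(k, Or A B) \<in> undischarged d" "undischarged d - {(k, Or A B)} \<subseteq> E \<union> P"
    using derivable_discharge_passive[OF assms(2) k False] .
  then show ?thesis
    unfolding derivable_def
    by (intro exI[of _ "Infer (OrI2 A B k) C [Assm n B, d]"])
       (auto simp: tree_simps intro!: deduction.intros separated.intros elim!: separated_mono)
qed (blast intro: derivable_mono)

text \<open>Half of the right rule for implication: it handles the consequent on the right, while
  \<open>derivable_TR\<close> brings the antecedent to the left.\<close>

lemma derivable_ImpI:
  assumes "finite E" and "\<And>k. derivable E (insert (k, Imp A B) P) C"
  shows "derivable E (insert (n, B) P) C"
proof (cases "derivable E P C")
  case False
  obtain k where k: "(k, Imp A B) \<notin> E" using fresh_class[OF assms(1)] by blast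
  obtain d where "deduction d" "separated (E - {(k, Imp A B)}) d" "concl d = C"
    "(k, Imp A B) \<in> undischarged d" "undischarged d - {(k, Imp A B)} \<subseteq> E \<union> P"
    using derivable_discharge_passive[OF assms(2) k False] .
  then show ?thesis
    unfolding derivable_def
    by (intro exI[of _ "Infer (ImpI A B k) C [Assm n B, d]"])
       (auto simp: tree_simps intro!: deduction.intros separated.intros elim!: separated_mono)
qed (blast intro: derivable_mono)

text \<open>If \<open>C\<close> did not follow already, both premises would use the classes to be
  discharged, and \<open>TR\<close> would apply without vacuous discharge.\<close>

lemma derivable_TR:
  assumes "finite E" and "derivable (E \<union> {(i, A)}) P C"
    and "\<And>k. derivable E (insert (k, Imp A B) P) C"
  shows "derivable E P C"
proof (rule ccontr)
  assume not: "\<not> derivable E P C"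
  obtain k where k: "(k, Imp A B) \<notin> E" using fresh_class[OF assms(1)] by blast
  obtain d where d: "deduction d" "separated (E - {(k, Imp A B)}) d" "concl d = C"
    "(k, Imp A B) \<in> undischarged d" "undischarged d - {(k, Imp A B)} \<subseteq> E \<union> P"
    using derivable_discharge_passive[OF assms(3) k not] .
  obtain d' where "deduction d'" "separated (E \<union> {(i, A)}) d'" "concl d' = C"
    "{(i, A)} \<inter> undischarged d' \<noteq> {}" "undischarged d' - {(i, A)} \<subseteq> E \<union> P"
    using derivable_discharge_eliminable[OF assms(2) not] .
  with d have "derivable E P C"
    unfolding derivable_def
    by (intro exI[of _ "Infer (TR A B i k) C [d', d]"])
       (auto simp: tree_simps intro!: deduction.intros separated.intros elim!: separated_mono)
  with not show False ..
qed

lemma derivable_NegI: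
  assumes "finite E" and "derivable (E \<union> {(i, A)}) P C"
    and "\<And>k. derivable E (insert (k, Neg A) P) C"
  shows "derivable E P C"
proof (rule ccontr)
  assume not: "\<not> derivable E P C"
  obtain k where k: "(k, Neg A) \<notin> E" using fresh_class[OF assms(1)] by blast
  obtain d where d: "deduction d" "separated (E - {(k, Neg A)}) d" "concl d = C"
    "(k, Neg A) \<in> undischarged d" "undischarged d - {(k, Neg A)} \<subseteq> E \<union> P"
    using derivable_discharge_passive[OF assms(3) k not] .
  obtain d' where "deduction d'" "separated (E \<union> {(i, A)}) d'" "concl d' = C"
    "{(i, A)} \<inter> undischarged d' \<noteq> {}" "undischarged d' - {(i, A)} \<subseteq> E \<union> P"
    using derivable_discharge_eliminable[OF assms(2) not] .
  with d have "derivable E P C"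
    unfolding derivable_def
    by (intro exI[of _ "Infer (NegI A i k) C [d', d]"])
       (auto simp: tree_simps intro!: deduction.intros separated.intros elim!: separated_mono)
  with not show False ..
qed

section \<open>Elimination rules as left rules\<close>

lemma derivable_AndE:
  assumes "(n, And A B) \<in> E" and "derivable (E \<union> {(i, A), (j, B)}) P C"
  shows "derivable E P C"
proof (rule ccontr)
  assume not: "\<not> derivable E P C"
  \<comment> \<open>Only one of the two classes need occur, which is all that \<open>AndE\<close>
    demands.\<close>
  obtain d where "deduction d" "separated (E \<union> {(i, A), (j, B)}) d" "concl d = C"
    "{(i, A), (j, B)} \<inter> undischarged d \<noteq> {}" "undischarged d - {(i, A), (j, B)} \<subseteq> E \<union> P"
    using derivable_discharge_eliminable[OF assms(2) not] .
  with assms(1) have "derivable E P C"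
    unfolding derivable_def
    by (intro exI[of _ "Infer (AndE A B i j) C [Assm n (And A B), d]"])
       (auto simp: tree_simps intro!: deduction.intros separated.intros elim!: separated_mono)
  with not show False ..
qed

lemma derivable_OrE:
  assumes "(n, Or A B) \<in> E" and "derivable (E \<union> {(i, A)}) P C" and "derivable (E \<union> {(j, B)}) P C"
  shows "derivable E P C"
proof (rule ccontr)
  assume not: "\<not> derivable E P C"
  obtain d where d: "deduction d" "separated (E \<union> {(i, A)}) d" "concl d = C"
    "{(i, A)} \<inter> undischarged d \<noteq> {}" "undischarged d - {(i, A)} \<subseteq> E \<union> P"
    using derivable_discharge_eliminable[OF assms(2) not] .
  obtain d' where "deduction d'" "separated (E \<union> {(j, B)}) d'" "concl d' = C"
    "{(j, B)} \<inter> undischarged d' \<noteq> {}" "undischarged d' - {(j, B)} \<subseteq> E \<union> P"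
    using derivable_discharge_eliminable[OF assms(3) not] .
  with d assms(1) have "derivable E P C"
    unfolding derivable_def
    by (intro exI[of _ "Infer (OrE A B i j) C [Assm n (Or A B), d, d']"])
       (auto simp: tree_simps intro!: deduction.intros separated.intros elim!: separated_mono)
  with not show False ..
qed

text \<open>The minor premise is a passive assumption \<open>A\<close>. The conclusion is thus
  exactly what allows \<open>A\<close> to join the right side of a sequent.\<close>

lemma derivable_ImpE:
  assumes "(n, Imp A B) \<in> E" and "derivable (E \<union> {(i, B)}) P C"
  shows "derivable E (insert (m, A) P) C"
proof (cases "derivable E P C")
  case False
  obtain d where "deduction d" "separated (E \<union> {(i, B)}) d" "concl d = C"
    "{(i, B)} \<inter> undischarged d \<noteq> {}" "undischarged d - {(i, B)} \<subseteq> E \<union> P"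
    using derivable_discharge_eliminable[OF assms(2) False] .
  with assms(1) show ?thesis
    unfolding derivable_def
    by (intro exI[of _ "Infer (ImpE A B i) C [Assm n (Imp A B), Assm m A, d]"])
       (auto simp: tree_simps intro!: deduction.intros separated.intros elim!: separated_mono)
qed (blast intro: derivable_mono)

lemma derivable_NegE:
  assumes "(n, Neg A) \<in> E"
  shows "derivable E (insert (m, A) P) C"
  using assms unfolding derivable_def
  by (intro exI[of _ "Infer (NegE A) C [Assm n (Neg A), Assm m A]"])
     (auto simp: tree_simps intro!: deduction.intros separated.intros)

section \<open>Completeness\<close>

text \<open>\<open>\<Gamma>\<close> and \<open>\<Delta>\<close> hold the formulas still to be decomposed, \<open>X\<close> and \<open>Y\<close> the atoms already met on the
  left and on the right.\<close>

definition sequent_holds ::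
    "('a \<Rightarrow> bool) \<Rightarrow> 'a form list \<Rightarrow> 'a set \<Rightarrow> 'a form list \<Rightarrow> 'a set \<Rightarrow> bool" where
  "sequent_holds v \<Gamma> X \<Delta> Y \<longleftrightarrow>
     (\<forall>A \<in> set \<Gamma>. holds v A) \<and> (\<forall>a \<in> X. v a) \<longrightarrow>
     (\<exists>A \<in> set \<Delta>. holds v A) \<or> (\<exists>a \<in> Y. v a)"

text \<open>These are equivalences, so validity passes from a sequent to the premises of the rule
  that decomposes it.\<close>

lemma sequent_holds_left [simp]:
  "sequent_holds v (Atom a # \<Gamma>) X \<Delta> Y \<longleftrightarrow> sequent_holds v \<Gamma> (insert a X) \<Delta> Y"
  "sequent_holds v (Neg A # \<Gamma>) X \<Delta> Y \<longleftrightarrow> sequent_holds v \<Gamma> X (A # \<Delta>) Y"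
  "sequent_holds v (Imp A B # \<Gamma>) X \<Delta> Y \<longleftrightarrow>
     sequent_holds v \<Gamma> X (A # \<Delta>) Y \<and> sequent_holds v (B # \<Gamma>) X \<Delta> Y"
  "sequent_holds v (And A B # \<Gamma>) X \<Delta> Y \<longleftrightarrow> sequent_holds v (A # B # \<Gamma>) X \<Delta> Y"
  "sequent_holds v (Or A B # \<Gamma>) X \<Delta> Y \<longleftrightarrow>
     sequent_holds v (A # \<Gamma>) X \<Delta> Y \<and> sequent_holds v (B # \<Gamma>) X \<Delta> Y"
  by (auto simp: sequent_holds_def)

lemma sequent_holds_right [simp]:
  "sequent_holds v \<Gamma> X (Atom a # \<Delta>) Y \<longleftrightarrow> sequent_holds v \<Gamma> X \<Delta> (insert a Y)"
  "sequent_holds v \<Gamma> X (Neg A # \<Delta>) Y \<longleftrightarrow> sequent_holds v (A # \<Gamma>) X \<Delta> Y"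
  "sequent_holds v \<Gamma> X (Imp A B # \<Delta>) Y \<longleftrightarrow> sequent_holds v (A # \<Gamma>) X (B # \<Delta>) Y"
  "sequent_holds v \<Gamma> X (And A B # \<Delta>) Y \<longleftrightarrow>
     sequent_holds v \<Gamma> X (A # \<Delta>) Y \<and> sequent_holds v \<Gamma> X (B # \<Delta>) Y"
  "sequent_holds v \<Gamma> X (Or A B # \<Delta>) Y \<longleftrightarrow> sequent_holds v \<Gamma> X (A # B # \<Delta>) Y"
  by (auto simp: sequent_holds_def)

text \<open>The third hypothesis is the reading of the right side: each member, taken as a passive
  assumption, yields \<open>C\<close>. Decomposing a formula means re-establishing this for the new
  members and extending \<open>E\<close> by the new formulas on the left.\<close>

lemma derivable_complete:
  fixes E P :: "'a assm_class set"
  assumes "finite E" and "set \<Gamma> \<union> Atom ` X \<subseteq> snd ` E"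
    and "\<And>A n. A \<in> set \<Delta> \<union> Atom ` Y \<Longrightarrow> derivable E (insert (n, A) P) C"
    and "\<forall>v. sequent_holds v \<Gamma> X \<Delta> Y"
  shows "derivable E P C"
  using assms
\<comment> \<open>Sizes are doubled so that a removed connective outweighs the extra list cell when
  one formula is replaced by two.\<close>
proof (induction "size_list (\<lambda>A. 2 * size A) \<Gamma> + size_list (\<lambda>A. 2 * size A) \<Delta>"
    arbitrary: E P \<Gamma> \<Delta> X Y rule: less_induct)
  case less
  note fin = less.prems(1) and left = less.prems(2) and right = less.prems(3)
    and valid = less.prems(4)
  have right': "derivable F (insert (n, A) Q) C"
    if "E \<subseteq> F" "P \<subseteq> Q" "A \<in> set \<Delta> \<union> Atom ` Y" for F Q n A
    by (rule derivable_mono[OF right[OF that(3)] that(1)]) (use that(2) in blast)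
  show ?case
  proof (cases \<Gamma>)
    case \<Gamma>: (Cons G \<Gamma>')
    then obtain n where n: "(n, G) \<in> E" using left by auto
    show ?thesis
    proof (cases G)
      case (Atom a)
      show ?thesis
        by (rule less.hyps[of \<Gamma>' \<Delta> E "insert a X" Y])
           (use \<Gamma> Atom fin left right valid in auto)
    next
      case (Neg A)
      show ?thesis
      proof (rule less.hyps[of \<Gamma>' "A # \<Delta>" E X Y])
        show "derivable E (insert (m, B) P) C" if "B \<in> set (A # \<Delta>) \<union> Atom ` Y" for B m
          using that right derivable_NegE n Neg by auto
      qed (use \<Gamma> Neg fin left valid in auto)
    next
      case (Imp A B)
      have B: "derivable (E \<union> {(0, B)}) P C"
        by (rule less.hyps[of "B # \<Gamma>'" \<Delta> _ X Y])
           (use \<Gamma> Imp fin left valid in \<open>auto intro: right'\<close>)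
      show ?thesis
      \<comment> \<open>The premise with \<open>B\<close> on the left has been used up in fact
        \<open>B\<close>; through \<open>derivable_ImpE\<close> it now justifies \<open>A\<close> on
        the right.\<close>
      proof (rule less.hyps[of \<Gamma>' "A # \<Delta>" E X Y])
        show "derivable E (insert (m, D) P) C" if "D \<in> set (A # \<Delta>) \<union> Atom ` Y" for D m
          using that right derivable_ImpE B n Imp by auto
      qed (use \<Gamma> Imp fin left valid in auto)
    next
      case (And A B)
      have "derivable (E \<union> {(0, A), (0, B)}) P C"
        by (rule less.hyps[of "A # B # \<Gamma>'" \<Delta> _ X Y])
           (use \<Gamma> And fin left valid in \<open>auto intro: right'\<close>)
      then show ?thesis using derivable_AndE n And by blast
    next
      case (Or A B)
      have "derivable (E \<union> {(0, A)}) P C"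
        by (rule less.hyps[of "A # \<Gamma>'" \<Delta> _ X Y])
           (use \<Gamma> Or fin left valid in \<open>auto intro: right'\<close>)
      moreover have "derivable (E \<union> {(0, B)}) P C"
        by (rule less.hyps[of "B # \<Gamma>'" \<Delta> _ X Y])
           (use \<Gamma> Or fin left valid in \<open>auto intro: right'\<close>)
      ultimately show ?thesis using derivable_OrE n Or by blast
    qed
  next
    case \<Gamma>: Nil
    show ?thesis
    proof (cases \<Delta>)
      case \<Delta>: (Cons G \<Delta>')
      have G: "derivable F (insert (n, G) Q) C" if "E \<subseteq> F" "P \<subseteq> Q" for F Q n
        using right'[OF that] \<Delta> by simp
      show ?thesis
      proof (cases G)
        case (Atom a)
        show ?thesis
          by (rule less.hyps[of \<Gamma> \<Delta>' E X "insert a Y"])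
             (use \<Delta> Atom fin left valid in \<open>auto intro: right\<close>)
      next
        case (Neg A)
        have "derivable (E \<union> {(0, A)}) P C"
          by (rule less.hyps[of "A # \<Gamma>" \<Delta>' _ X Y])
             (use \<Delta> Neg fin left valid in \<open>auto intro: right'\<close>)
        from derivable_NegI[OF fin this] show ?thesis using G Neg by simp
      next
        case (Imp A B)
        have "derivable (E \<union> {(0, A)}) P C"
        \<comment> \<open>\<open>B\<close> may join the right side because \<open>ImpI\<close> turns
          it into the implication, which is there already.\<close>
        proof (rule less.hyps[of "A # \<Gamma>" "B # \<Delta>'" _ X Y])
          have "derivable (E \<union> {(0, A)}) (insert (m, B) P) C" for m
            by (rule derivable_ImpI[of _ A]) (use fin G Imp in \<open>simp_all add: subset_insertI\<close>)
          then show "derivable (E \<union> {(0, A)}) (insert (m, D) P) C"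
            if "D \<in> set (B # \<Delta>') \<union> Atom ` Y" for D m
            using that \<Delta> by (auto intro: right')
        qed (use \<Delta> Imp fin left valid in auto)
        from derivable_TR[OF fin this, of B] show ?thesis using G Imp by simp
      next
        case (And A B)
        \<comment> \<open>With both conjuncts passive, \<open>AndI\<close> gives \<open>C\<close>.
          The two premises of the right rule then remove first \<open>B\<close>, with
          \<open>A\<close> still passive, and afterwards \<open>A\<close>.\<close>
        have AB: "derivable E (insert (m, B) (insert (k, A) P)) C" for k m
          by (subst insert_commute, rule derivable_AndI) (use fin G And in \<open>simp_all add: subset_insertI\<close>)
        have A: "derivable E (insert (k, A) P) C" for k
        proof (rule less.hyps[of \<Gamma> "B # \<Delta>'" _ X Y])
          show "derivable E (insert (m, D) (insert (k, A) P)) C"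
            if "D \<in> set (B # \<Delta>') \<union> Atom ` Y" for D m
            by (cases "D = B") (use that \<Delta> AB in \<open>auto intro!: right'\<close>)
        qed (use \<Delta> And fin left valid in auto)
        show ?thesis
        proof (rule less.hyps[of \<Gamma> "A # \<Delta>'" _ X Y])
          show "derivable E (insert (m, D) P) C" if "D \<in> set (A # \<Delta>') \<union> Atom ` Y" for D m
            using that right \<Delta> A by auto
        qed (use \<Delta> And fin left valid in auto)
      next
        case (Or A B)
        have A: "derivable E (insert (k, A) P) C" for k
          by (rule derivable_OrI1[of _ A B]) (use fin G Or in \<open>simp_all add: subset_insertI\<close>)
        have B: "derivable E (insert (k, B) P) C" for k
          by (rule derivable_OrI2[of _ A B]) (use fin G Or in \<open>simp_all add: subset_insertI\<close>)
        show ?thesis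
        proof (rule less.hyps[of \<Gamma> "A # B # \<Delta>'" _ X Y])
          show "derivable E (insert (m, D) P) C" if "D \<in> set (A # B # \<Delta>') \<union> Atom ` Y" for D m
            using that right \<Delta> A B by auto
        qed (use \<Delta> Or fin left valid in auto)
      qed
    next
      case Nil
      \<comment> \<open>Only atoms are left. The valuation true exactly on \<open>X\<close> must
        make an atom of \<open>Y\<close> true.\<close>
      with valid[rule_format, of "\<lambda>a. a \<in> X"] \<Gamma> obtain a where a: "a \<in> X" "a \<in> Y"
        by (auto simp: sequent_holds_def)
      then obtain n where n: "(n, Atom a) \<in> E" using left by auto
      \<comment> \<open>Reusing the number \<open>n\<close> of a class in \<open>E\<close> makes the
        added passive assumption one already available.\<close>
      have "derivable E (insert (n, Atom a) P) C" using right a by blast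
      moreover have "E \<union> insert (n, Atom a) P = E \<union> P" using n by auto
      ultimately show ?thesis by (simp add: derivable_def)
    qed
  qed
qed

theorem theorem2:
  fixes d :: "'a tree"
  assumes "deduction d"
  shows "\<exists>d'. deduction d' \<and> normal d' \<and> concl d' = concl d \<and>
           undischarged d' \<subseteq> undischarged d"
proof -
  obtain \<Gamma> where \<Gamma>: "set \<Gamma> = snd ` undischarged d"
    using finite_list finite_imageI finite_undischarged by metis
  have "derivable (undischarged d) {} (concl d)"
  \<comment> \<open>With the conclusion alone on the right, the third hypothesis is met by a single
    assumption.\<close>
  proof (rule derivable_complete[of _ \<Gamma> "{}" "[concl d]" "{}"])
    show "\<forall>v. sequent_holds v \<Gamma> {} [concl d] {}"
      using deduction_sound[OF assms] \<Gamma> by (auto simp: sequent_holds_def)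
  qed (use \<Gamma> in \<open>auto intro: finite_undischarged derivable_Assm\<close>)
  then show ?thesis unfolding derivable_def by (auto intro: separated_normal)
qed

end
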